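(* Let $\mu=\max_{a>0}\dfrac{2+2a-a^2}{\sqrt{2}\sqrt{1+a}}=\left(\tfrac{2}{3}\right)^{3/2}\dfrac{1+2\sqrt{7}}{\sqrt{2+\sqrt{7}}}\approx1.58887$. There exists a function $g$ with $g(r)/r\to0$ as $r\to\infty$ such that for every positive integer $r$ there exists a $\overline{\mathrm{DD}}^*(m,r)$ with $m\ge(\mu/2)r-g(r)$ (so $m\approx0.79444\,r$).
   Context: Represent the hexagonal grid by $\mathbb{Z}^2$, where $(i,j)$ has neighbours $(i\pm1,j)$, $(i,j\pm1)$, $(i+1,j+1)$, $(i-1,j-1)$ (the adjacency graph of a regular hexagonal tiling, identifying $(i,j)$ with the plane point $i(1,0)+j(-\tfrac12,\tfrac{\sqrt3}{2})$). The hexagonal distance is the graph distance in this graph. A $\overline{\mathrm{DD}}^*(m,r)$ is a set of $m$ grid points ("dots") such that any two dots are at hexagonal distance at most $r$, and the vectors $a-b$, over ordered pairs $(a,b)$ of distinct dots, are pairwise distinct (i.e. the lines joining pairs of dots differ in length or slope). *)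

theory Defs
  imports Complex_Main "HOL-Library.Product_Plus"
begin

definition hex_adj :: "((int \<times> int) \<times> (int \<times> int)) set" where
  "hex_adj = {(p, q). q - p \<in> {(1, 0), (-1, 0), (0, 1), (0, -1), (1, 1), (-1, -1)}}"

text \<open>Graph distance: the least number of edges of a walk from \<open>p\<close> to \<open>q\<close>.
  The graph is connected, so such a walk always exists.\<close>

definition hex_dist :: "int \<times> int \<Rightarrow> int \<times> int \<Rightarrow> nat" where
  "hex_dist p q = (LEAST n. (p, q) \<in> hex_adj ^^ n)"

lemma hex_adj_connected: "(p, q) \<in> hex_adj\<^sup>*"
proof -
  have h: "(p, (fst p + k, snd p)) \<in> hex_adj\<^sup>*" for p k
  proof (induction k rule: int_induct[where k = 0])
    case base
    then show ?case by simp
  next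
    case (step1 i)
    have "((fst p + i, snd p), (fst p + (i + 1), snd p)) \<in> hex_adj"
      by (simp add: hex_adj_def)
    with step1 show ?case by (meson rtrancl.rtrancl_into_rtrancl)
  next
    case (step2 i)
    have "((fst p + i, snd p), (fst p + (i - 1), snd p)) \<in> hex_adj"
      by (simp add: hex_adj_def)
    with step2 show ?case by (meson rtrancl.rtrancl_into_rtrancl)
  qed
  have v: "(p, (fst p, snd p + k)) \<in> hex_adj\<^sup>*" for p k
  proof (induction k rule: int_induct[where k = 0])
    case base
    then show ?case by simp
  next
    case (step1 i)
    have "((fst p, snd p + i), (fst p, snd p + (i + 1))) \<in> hex_adj"
      by (simp add: hex_adj_def)
    with step1 show ?case by (meson rtrancl.rtrancl_into_rtrancl)
  next
    case (step2 i)
    have "((fst p, snd p + i), (fst p, snd p + (i - 1))) \<in> hex_adj"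
      by (simp add: hex_adj_def)
    with step2 show ?case by (meson rtrancl.rtrancl_into_rtrancl)
  qed
  have "(p, (fst q, snd p)) \<in> hex_adj\<^sup>*"
    using h[of p "fst q - fst p"] by simp
  moreover have "((fst q, snd p), q) \<in> hex_adj\<^sup>*"
    using v[of "(fst q, snd p)" "snd q - snd p"] by simp
  ultimately show ?thesis by (rule rtrancl_trans)
qed

definition DD_bar_star :: "nat \<Rightarrow> nat \<Rightarrow> (int \<times> int) set \<Rightarrow> bool" where
  "DD_bar_star m r A \<longleftrightarrow>
     finite A \<and> card A = m \<and>
     (\<forall>a\<in>A. \<forall>b\<in>A. hex_dist a b \<le> r) \<and>
     inj_on (\<lambda>(a, b). a - b) {(a, b). a \<in> A \<and> b \<in> A \<and> a \<noteq> b}"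

definition mu_fun :: "real \<Rightarrow> real" where
  "mu_fun a = (2 + 2 * a - a\<^sup>2) / (sqrt 2 * sqrt (1 + a))"

text \<open>\<open>GREATEST\<close> is meaningful only if the maximum is attained; the theorem
  therefore asserts this as well.\<close>

definition mu :: real where
  "mu = (GREATEST y. y \<in> mu_fun ` {0<..})"

end

theory Submission
  imports Defs "HOL-Number_Theory.Number_Theory" "HOL-Real_Asymp.Real_Asymp"
    "HOL-Library.Discrete_Functions"
begin

text \<open>
  For a prime \<open>p\<close> with primitive root \<open>a\<close>, the pairs \<open>(i, a\<^sup>i)\<close> form a Sidon set with \<open>p - 1\<close> elements in
  the cyclic group \<open>\<int>\<^bsub>p-1\<^esub> \<times> \<int>\<^sub>p\<close>. A homomorphism from the grid to this group that is injective on a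
  window pulls every translate of the Sidon set back to a set of dots with distinct differences,
  and some translate has at least \<open>|window| / p\<close> dots in the window. Choosing the kernel close to a
  regular hexagonal lattice of index \<open>p(p - 1)\<close>, the window may be a regular hexagon of diameter up
  to about \<open>2p / sqrt 3\<close>. In the ideal case \<open>p = (sqrt 3 / 2) r\<close> this gives about \<open>(sqrt 3 / 2) r = 0.866 r\<close>
  dots. As \<open>0.866 > \<mu>/2\<close>, a prime \<open>p\<close> between \<open>0.8 r\<close> and \<open>0.944 r\<close> is enough.
  The ratio of these bounds is just within reach of Chebyshev's elementary estimates for \<open>\<psi>\<close> after
  one improvement step. Since all these inequalities are strict, \<open>g\<close> can be taken to vanish for large \<open>r\<close>.
\<close>

section \<open>Hexagonal distance\<close>

text \<open>The largest of \<open>|x|\<close>, \<open>|y|\<close>, \<open>|x - y|\<close> is the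
  hexagonal norm of \<open>(x, y)\<close>. For a nonzero vector, a step chosen by the signs of
  \<open>x\<close> and \<open>y\<close>, diagonal when both are positive or both negative, lowers it
  by one.\<close>

lemma hex_walk:
  assumes "\<bar>x\<bar> \<le> int n" "\<bar>y\<bar> \<le> int n" "\<bar>x - y\<bar> \<le> int n"
  shows "\<exists>k\<le>n. (p, p + (x, y)) \<in> hex_adj ^^ k"
  using assms
proof (induction n arbitrary: x y p)
  case 0
  then have "(x, y) = 0" by (simp add: zero_prod_def)
  then show ?case by auto
next
  case (Suc n)
  consider "x = 0 \<and> y = 0"
    | u v where "(u, v) \<in> {(1, 0), (-1, 0), (0, 1), (0, -1), (1, 1), (-1, -1)}"
        "\<bar>x - u\<bar> \<le> int n" "\<bar>y - v\<bar> \<le> int n" "\<bar>(x - u) - (y - v)\<bar> \<le> int n"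
  proof -
    consider "x = 0 \<and> y = 0" | "x > 0 \<and> y > 0" | "x < 0 \<and> y < 0" | "x > 0 \<and> y \<le> 0"
      | "x < 0 \<and> y \<ge> 0" | "x = 0 \<and> y > 0" | "x = 0 \<and> y < 0" by linarith
    then show thesis
    proof cases
      case 1 then show ?thesis using that(1) by simp
    next
      case 2 then show ?thesis using Suc.prems by (intro that(2)[of 1 1]) auto
    next
      case 3 then show ?thesis using Suc.prems by (intro that(2)[of "-1" "-1"]) auto
    next
      case 4 then show ?thesis using Suc.prems by (intro that(2)[of 1 0]) auto
    next
      case 5 then show ?thesis using Suc.prems by (intro that(2)[of "-1" 0]) auto
    next
      case 6 then show ?thesis using Suc.prems by (intro that(2)[of 0 1]) auto
    next
      case 7 then show ?thesis using Suc.prems by (intro that(2)[of 0 "-1"]) auto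
    qed
  qed
  then show ?case
  proof cases
    case 1
    then have "(x, y) = 0" by (simp add: zero_prod_def)
    then show ?thesis by (intro exI[of _ 0]) simp
  next
    case 2
    have "(p, p + (u, v)) \<in> hex_adj"
      using 2(1) by (simp add: hex_adj_def)
    moreover obtain k where k: "k \<le> n"
        "(p + (u, v), p + (u, v) + (x - u, y - v)) \<in> hex_adj ^^ k"
      using Suc.IH[OF 2(2-4)] by blast
    ultimately have "(p, p + (u, v) + (x - u, y - v)) \<in> hex_adj ^^ Suc k"
      by (meson relpow_Suc_I2)
    then show ?thesis using k(1) by (intro exI[of _ "Suc k"]) (simp add: add.assoc)
  qed
qed

lemma hex_dist_le:
  assumes "\<bar>fst q - fst p\<bar> \<le> int n" "\<bar>snd q - snd p\<bar> \<le> int n"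
    "\<bar>(fst q - fst p) - (snd q - snd p)\<bar> \<le> int n"
  shows "hex_dist p q \<le> n"
proof -
  have "p + (fst q - fst p, snd q - snd p) = q"
    by (simp add: prod_eq_iff)
  then obtain k where "k \<le> n" "(p, q) \<in> hex_adj ^^ k"
    using hex_walk[OF assms, of p] by metis
  then show ?thesis
    unfolding hex_dist_def by (meson Least_le order_trans)
qed

text \<open>This is the ball of radius \<open>R\<close> about \<open>(R, R)\<close> in the hexagonal
  norm, so its diameter is \<open>2 * R\<close>.\<close>

definition hexagon :: "nat \<Rightarrow> (int \<times> int) set" where
  "hexagon R = {(x, y). 0 \<le> x \<and> x \<le> 2 * int R \<and> 0 \<le> y \<and> y \<le> 2 * int R \<and> \<bar>x - y\<bar> \<le> int R}"

lemma finite_hexagon: "finite (hexagon R)"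
  by (rule finite_subset[of _ "{0..2 * int R} \<times> {0..2 * int R}"]) (auto simp: hexagon_def)

text \<open>Drop the last column and one point of every other column. For \<open>i < R\<close> the
  columns \<open>i\<close> and \<open>R + i\<close> then hold \<open>R + i\<close> and
  \<open>2 * R - i\<close> points, together \<open>3 * R\<close>.\<close>

lemma card_hexagon_ge: "3 * R\<^sup>2 \<le> card (hexagon R)"
proof -
  define S where "S = (SIGMA i:{..<R}. {..<R + i})"
  define T where "T = (SIGMA i:{..<R}. {..<2 * R - i})"
  define f where "f = (\<lambda>(i, j). (int i, int j))"
  define h where "h = (\<lambda>(i, j). (int R + int i, int i + int j))"
  have inj: "inj_on f S" "inj_on h T"
    by (auto simp: inj_on_def f_def h_def)
  have sum: "(\<Sum>i<R. R + i) + (\<Sum>i<R. 2 * R - i) = 3 * R\<^sup>2"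
  proof -
    have "(\<Sum>i<R. R + i) + (\<Sum>i<R. 2 * R - i) = (\<Sum>i<R. 3 * R)"
      unfolding sum.distrib[symmetric] by (intro sum.cong) auto
    then show ?thesis by (simp add: power2_eq_square)
  qed
  have "3 * R\<^sup>2 = card S + card T"
    unfolding S_def T_def using sum by simp
  also have "\<dots> = card (f ` S) + card (h ` T)"
    by (simp add: card_image inj)
  also have "\<dots> = card (f ` S \<union> h ` T)"
    by (rule card_Un_disjoint[symmetric]) (auto simp: S_def T_def f_def h_def)
  also have "\<dots> \<le> card (hexagon R)"
    by (rule card_mono[OF finite_hexagon]) (auto simp: hexagon_def S_def T_def f_def h_def)
  finally show ?thesis .
qed

section \<open>Sidon sets from primitive roots\<close>

text \<open>Reducing the exponent modulo \<open>p - 1\<close> first gives powers modulo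
  \<open>p\<close> a meaning for negative exponents too.\<close>

definition primroot_pow :: "nat \<Rightarrow> nat \<Rightarrow> int \<Rightarrow> int" where
  "primroot_pow p g n = int g ^ nat (n mod int (p - 1))"

lemma primroot_power_cong_iff:
  assumes "prime p" "residue_primroot p g"
  shows "[int g ^ i = int g ^ j] (mod int p) \<longleftrightarrow> [int i = int j] (mod int (p - 1))"
proof -
  have "[g ^ i = g ^ j] (mod p) \<longleftrightarrow> [i = j] (mod (p - 1))"
    using assms order_divides_expdiff[of p g i j] by (simp add: residue_primroot_def totient_prime)
  then show ?thesis
    by (metis cong_int_iff of_nat_power)
qed

lemma primroot_pow_cong_iff:
  assumes "prime p" "residue_primroot p g"
  shows "[primroot_pow p g m = primroot_pow p g n] (mod int p) \<longleftrightarrow> [m = n] (mod int (p - 1))"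
proof -
  have "int (p - 1) > 0" using prime_gt_1_nat[OF assms(1)] by simp
  then show ?thesis
    unfolding primroot_pow_def primroot_power_cong_iff[OF assms] by (simp add: cong_def)
qed

lemma primroot_pow_add:
  assumes "prime p" "residue_primroot p g"
  shows "[primroot_pow p g (m + n) = primroot_pow p g m * primroot_pow p g n] (mod int p)"
proof -
  have "int (p - 1) > 0" using prime_gt_1_nat[OF assms(1)] by simp
  then show ?thesis
    unfolding primroot_pow_def power_add[symmetric] primroot_power_cong_iff[OF assms]
    by (simp del: of_nat_diff) (rule cong_add; simp add: cong_def)
qed

text \<open>By the Chinese remainder theorem the group is cyclic of order
  \<open>p * (p - 1)\<close>, and the integers \<open>n\<close> with \<open>g^n - n = s\<close>
  modulo \<open>p\<close> form a translate of the Sidon set. If \<open>a - b = c - d\<close> has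
  image \<delta>, then \<open>g^\<delta> - 1\<close> times
  \<open>g^(\<phi> b) - g^(\<phi> d)\<close> vanishes modulo \<open>p\<close>, and the first factor
  cancels.\<close>

lemma primroot_fibre_distinct_differences:
  fixes \<phi> :: "'a::ab_group_add \<Rightarrow> int"
  assumes p: "prime p" "residue_primroot p g"
    and diff: "\<And>a b. \<phi> (a - b) = \<phi> a - \<phi> b"
    and inj: "\<And>a b. a \<in> A \<Longrightarrow> b \<in> A \<Longrightarrow> int (p * (p - 1)) dvd \<phi> a - \<phi> b \<Longrightarrow> a = b"
    and fibre: "\<And>a. a \<in> A \<Longrightarrow> [primroot_pow p g (\<phi> a) - \<phi> a = s] (mod int p)"
  shows "inj_on (\<lambda>(a, b). a - b) {(a, b). a \<in> A \<and> b \<in> A \<and> a \<noteq> b}"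
proof -
  let ?G = "primroot_pow p g"
  have p1: "p > 1" using prime_gt_1_nat[OF p(1)] .
  have cop: "coprime (int p) (int (p - 1))"
    using p1 by (metis coprime_commute coprime_diff_one_left_nat coprime_int_iff less_trans zero_less_one)
  \<comment> \<open>In a fibre, the residue of \<open>\<phi> a\<close> modulo \<open>p - 1\<close>
    determines the one modulo \<open>p\<close>, hence the one modulo
    \<open>p * (p - 1)\<close>.\<close>
  have eqI: "a = b" if "a \<in> A" "b \<in> A" "[\<phi> a = \<phi> b] (mod int (p - 1))" for a b
  proof -
    have "[?G (\<phi> a) = ?G (\<phi> b)] (mod int p)"
      using that(3) primroot_pow_cong_iff[OF p] by blast
    moreover have "[?G (\<phi> a) - \<phi> a = ?G (\<phi> b) - \<phi> b] (mod int p)"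
      using fibre[OF that(1)] fibre[OF that(2)] by (metis cong_sym cong_trans)
    ultimately have "[\<phi> a = \<phi> b] (mod int p)"
      using cong_diff[of "?G (\<phi> a)" "?G (\<phi> b)" "int p" "?G (\<phi> a) - \<phi> a" "?G (\<phi> b) - \<phi> b"] by simp
    then have "int p * int (p - 1) dvd \<phi> a - \<phi> b"
      using that(3) cop by (intro divides_mult) (simp_all add: cong_iff_dvd_diff)
    then show "a = b" using inj[OF that(1,2)] by simp
  qed
  have main: "b = d"
    if A: "a \<in> A" "b \<in> A" "c \<in> A" "d \<in> A" and ne: "a \<noteq> b" and eq: "a - b = c - d" for a b c d
  proof -
    define \<delta> where "\<delta> = \<phi> a - \<phi> b"
    have \<delta>: "\<phi> a = \<delta> + \<phi> b" "\<phi> c = \<delta> + \<phi> d"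
      using diff[of a b] diff[of c d] eq by (simp_all add: \<delta>_def)
    have ndvd: "\<not> [?G \<delta> = ?G 0] (mod int p)"
    proof
      assume "[?G \<delta> = ?G 0] (mod int p)"
      then have "[\<phi> a = \<phi> b] (mod int (p - 1))"
        unfolding primroot_pow_cong_iff[OF p] by (simp add: \<delta> cong_iff_dvd_diff)
      then show False using eqI[OF A(1,2)] ne by simp
    qed
    have "[?G (\<phi> a) - \<phi> a - (?G (\<phi> b) - \<phi> b) = ?G (\<phi> c) - \<phi> c - (?G (\<phi> d) - \<phi> d)] (mod int p)"
      using cong_diff[OF cong_trans[OF fibre[OF A(1)] cong_sym[OF fibre[OF A(3)]]]
          cong_trans[OF fibre[OF A(2)] cong_sym[OF fibre[OF A(4)]]]] .
    \<comment> \<open>The linear parts cancel because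
      \<open>\<phi> a - \<phi> b = \<phi> c - \<phi> d\<close>.\<close>
    then have G: "[?G (\<phi> a) - ?G (\<phi> b) = ?G (\<phi> c) - ?G (\<phi> d)] (mod int p)"
      by (simp add: \<delta> cong_iff_dvd_diff algebra_simps)
    have Gab: "[?G (\<phi> a) - ?G (\<phi> b) = ?G \<delta> * ?G (\<phi> b) - ?G (\<phi> b)] (mod int p)"
      unfolding \<delta> by (intro cong_diff primroot_pow_add[OF p] cong_refl)
    have Gcd: "[?G (\<phi> c) - ?G (\<phi> d) = ?G \<delta> * ?G (\<phi> d) - ?G (\<phi> d)] (mod int p)"
      unfolding \<delta> by (intro cong_diff primroot_pow_add[OF p] cong_refl)
    have "[?G \<delta> * ?G (\<phi> b) - ?G (\<phi> b) = ?G \<delta> * ?G (\<phi> d) - ?G (\<phi> d)] (mod int p)"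
      using cong_trans[OF cong_sym[OF Gab] cong_trans[OF G Gcd]] .
    then have "int p dvd (?G \<delta> - 1) * (?G (\<phi> b) - ?G (\<phi> d))"
      by (simp add: cong_iff_dvd_diff algebra_simps)
    moreover have "\<not> int p dvd ?G \<delta> - 1"
      using ndvd by (simp add: cong_iff_dvd_diff primroot_pow_def)
    ultimately have "[?G (\<phi> b) = ?G (\<phi> d)] (mod int p)"
      using p(1) by (simp add: cong_iff_dvd_diff prime_dvd_mult_iff)
    then show "b = d"
      using eqI[OF A(2,4)] unfolding primroot_pow_cong_iff[OF p] by blast
  qed
  show ?thesis
  proof (rule inj_onI, clarsimp)
    fix a b c d assume *: "a - b = c - d" "a \<in> A" "b \<in> A" "a \<noteq> b" "c \<in> A" "d \<in> A"
    then have "b = d" using main by blast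
    with *(1) show "a = c \<and> b = d" by simp
  qed
qed

section \<open>Nearly hexagonal lattices of prescribed index\<close>

text \<open>The lattice is spanned by \<open>(2b + e, b + 2 + 2e - j)\<close> and \<open>(b, 2b + 1)\<close>, small perturbations of
  the vectors \<open>b(2, 1)\<close> and \<open>b(1, 2)\<close> of a regular hexagonal lattice with minimal distance \<open>2b\<close>. The
  entry \<open>2b + 1\<close> instead of \<open>2b\<close> makes the quotient cyclic.\<close>

lemma hex_lattice_min_dist:
  fixes b j e x y R \<delta> :: int
  assumes N: "3 * b\<^sup>2 + j * b + e dvd (2 * b + 1) * x - b * y"
    and small: "\<bar>j\<bar> \<le> \<delta>" "\<bar>e\<bar> \<le> \<delta>"
    and R: "0 \<le> R" "R < b - (3 * \<delta> + 3)"
    and bounds: "\<bar>x\<bar> \<le> 2 * R" "\<bar>y\<bar> \<le> 2 * R" "\<bar>x - y\<bar> \<le> 2 * R"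
  shows "x = 0 \<and> y = 0"
proof -
  \<comment> \<open>This bounds the sum of the absolute coefficients of \<open>k\<close> and
    \<open>l\<close> in each perturbation below; the worst is
    \<open>(2 + 2 * e - j) * k + l\<close>.\<close>
  define \<kappa> where "\<kappa> = 3 * \<delta> + 3"
  have b: "b > \<kappa>" "b > 0" "\<kappa> > 0" using small R by (auto simp: \<kappa>_def)
  obtain k where k: "(2 * b + 1) * x - b * y = (3 * b\<^sup>2 + j * b + e) * k"
    using N by (auto simp: dvd_def)
  \<comment> \<open>The linear form takes the value \<open>3 * b^2 + j * b + e\<close> at the first
    spanning vector. Removing \<open>k\<close> copies leaves an integer zero of the form, a multiple
    of \<open>(b, 2 * b + 1)\<close> by coprimality.\<close>
  define X where "X = x - k * (2 * b + e)"
  define Y where "Y = y - k * (b + 2 + 2 * e - j)"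
  have XY: "(2 * b + 1) * X = b * Y"
    using k by (simp add: X_def Y_def algebra_simps power2_eq_square)
  have "coprime b (2 * b + 1)"
    by (metis coprime_1_right coprime_iff_gcd_eq_1 gcd_add_mult)
  then have "b dvd X"
    using XY by (metis coprime_dvd_mult_right_iff dvd_triv_left)
  then obtain l where l: "X = b * l" by (auto simp: dvd_def)
  have "b * Y = b * ((2 * b + 1) * l)" using XY by (simp add: l algebra_simps)
  then have l': "Y = (2 * b + 1) * l" using b by (metis mult_left_cancel less_irrefl)
  have x: "x = b * (2 * k + l) + e * k" and y: "y = b * (k + 2 * l) + ((2 + 2 * e - j) * k + l)"
    using l l' by (simp_all add: X_def Y_def algebra_simps)
  have d: "x - y = b * (k - l) + ((j - e - 2) * k - l)"
    unfolding x y by (simp add: algebra_simps)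
  define m where "m = max \<bar>k\<bar> \<bar>l\<bar>"
  have m: "\<bar>k\<bar> \<le> m" "\<bar>l\<bar> \<le> m" "0 \<le> m" by (auto simp: m_def)
  \<comment> \<open>The unperturbed coordinate \<open>b * P\<close> dominates: the sum has size at
    least \<open>|P| * (b - \<kappa>)\<close>, which exceeds \<open>2 * R\<close>.\<close>
  have big: False
    if P: "2 \<le> \<bar>P\<bar>" "m \<le> \<bar>P\<bar>" and Q: "\<bar>Q\<bar> \<le> \<kappa> * m" and le: "\<bar>b * P + Q\<bar> \<le> 2 * R" for P Q
  proof -
    have "2 * (b - \<kappa>) \<le> \<bar>P\<bar> * (b - \<kappa>)"
      using P b by (intro mult_right_mono) auto
    also have "\<dots> = b * \<bar>P\<bar> - \<kappa> * \<bar>P\<bar>" by (simp add: algebra_simps)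
    also have "\<dots> \<le> b * \<bar>P\<bar> - \<kappa> * m"
      using P b by (simp add: mult_left_mono)
    also have "\<dots> \<le> \<bar>b * P\<bar> - \<bar>Q\<bar>" using Q b by (simp add: abs_mult)
    also have "\<dots> \<le> \<bar>b * P + Q\<bar>" by linarith
    finally show False using le R by (simp add: \<kappa>_def)
  qed
  have lin: "\<bar>s * k + t * l\<bar> \<le> \<kappa> * m" if "\<bar>s\<bar> + \<bar>t\<bar> \<le> \<kappa>" for s t
  proof -
    have "\<bar>s * k + t * l\<bar> \<le> \<bar>s\<bar> * \<bar>k\<bar> + \<bar>t\<bar> * \<bar>l\<bar>"
      by (metis abs_mult abs_triangle_ineq)
    also have "\<dots> \<le> \<bar>s\<bar> * m + \<bar>t\<bar> * m"
      using m by (intro add_mono mult_left_mono) auto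
    also have "\<dots> = (\<bar>s\<bar> + \<bar>t\<bar>) * m" by (simp add: algebra_simps)
    also have "\<dots> \<le> \<kappa> * m" using that m by (intro mult_right_mono) auto
    finally show ?thesis .
  qed
  have "k = 0 \<and> l = 0"
  proof (rule ccontr)
    assume "\<not> (k = 0 \<and> l = 0)"
    \<comment> \<open>If \<open>k\<close> and \<open>l\<close> have opposite signs,
      \<open>k - l\<close> is large; otherwise \<open>2 * k + l\<close> or \<open>k + 2 * l\<close>
      is.\<close>
    then consider "2 \<le> \<bar>2 * k + l\<bar>" "m \<le> \<bar>2 * k + l\<bar>" | "2 \<le> \<bar>k + 2 * l\<bar>" "m \<le> \<bar>k + 2 * l\<bar>"
      | "2 \<le> \<bar>k - l\<bar>" "m \<le> \<bar>k - l\<bar>"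
      unfolding m_def by linarith
    then show False
    proof cases
      case 1
      then show ?thesis
        using big[of "2 * k + l" "e * k"] lin[of e 0] bounds(1) small b by (simp add: x \<kappa>_def)
    next
      case 2
      then show ?thesis
        using big[of "k + 2 * l" "(2 + 2 * e - j) * k + l"] lin[of "2 + 2 * e - j" 1] bounds(2) small b
        unfolding y \<kappa>_def by fastforce
    next
      case 3
      then show ?thesis
        using big[of "k - l" "(j - e - 2) * k - l"] lin[of "j - e - 2" "-1"] bounds(3) small b
        unfolding d \<kappa>_def by fastforce
    qed
  qed
  then show ?thesis by (simp add: x y)
qed

text \<open>Completing the square turns \<open>N = 3b\<^sup>2 + jb + e\<close> into \<open>(6b + j)\<^sup>2 - j\<^sup>2 = 12(N - e)\<close>,
  so \<open>6b + j\<close> is the square root of \<open>12N\<close> rounded up and \<open>j\<close> that of the excess.\<close>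

lemma hex_form_approx:
  fixes N :: nat
  shows "\<exists>(b::int) j e (s::nat) (w::nat). int N = 3 * b\<^sup>2 + j * b + e \<and> \<bar>j\<bar> \<le> int s + 5 \<and> \<bar>e\<bar> \<le> int s + 5
    \<and> 6 * b \<ge> int w - int s \<and> s\<^sup>2 \<le> 2 * w \<and> 12 * N < w\<^sup>2 \<and> (w - 1)\<^sup>2 \<le> 12 * N"
proof -
  obtain v :: nat where v: "v\<^sup>2 \<le> 12 * N" "12 * N < (v + 1)\<^sup>2"
    using floor_sqrt_power2_le Suc_floor_sqrt_power2_gt by (metis Suc_eq_plus1)
  define w where "w = v + 1"
  define D where "D = w\<^sup>2 - 12 * N"
  obtain s :: nat where s: "s\<^sup>2 \<le> D" "D < (s + 1)\<^sup>2"
    using floor_sqrt_power2_le Suc_floor_sqrt_power2_gt by (metis Suc_eq_plus1)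
  have D: "int D = (int w)\<^sup>2 - 12 * int N"
    using v by (simp add: D_def w_def of_nat_diff)
  have s2: "s\<^sup>2 \<le> 2 * w"
    using s(1) v by (simp add: D_def w_def power2_eq_square)
  \<comment> \<open>The largest integer up to \<open>s\<close> congruent to \<open>w\<close> modulo
    6, so that \<open>b = (w - j) / 6\<close> is an integer. It may be negative when
    \<open>s < 5\<close>, whence the case distinctions below.\<close>
  define j where "j = int s - (int s - int w) mod 6"
  have "6 dvd int w - j" unfolding j_def by presburger
  then obtain b where b: "int w - j = 6 * b" by (auto simp: dvd_def)
  define e where "e = int N - 3 * b\<^sup>2 - j * b"
  have j: "j \<le> int s" "int s - 5 \<le> j" unfolding j_def by presburger+
  have w: "int w = 6 * b + j" using b by simp
  have e: "12 * e = j\<^sup>2 - int D"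
    unfolding D w e_def by (simp add: power2_eq_square algebra_simps)
  have s': "(int s)\<^sup>2 \<le> int D" "int D < (int s + 1)\<^sup>2"
    using s by (metis of_nat_le_iff of_nat_power) (metis s(2) of_nat_1 of_nat_add of_nat_less_iff of_nat_power)
  have "j\<^sup>2 \<le> (int s)\<^sup>2 + 25"
  proof (cases "j \<ge> 0")
    case True
    then have "j\<^sup>2 \<le> (int s)\<^sup>2" using j by (intro power_mono) auto
    then show ?thesis by simp
  next
    case False
    then have "\<bar>j\<bar> \<le> 5" using j by simp
    then have "j\<^sup>2 \<le> 5\<^sup>2" by (metis power2_abs power_mono abs_ge_zero)
    moreover have "0 \<le> (int s)\<^sup>2" by simp
    ultimately show ?thesis by (simp only: power2_eq_square)
  qed
  moreover have "(int s)\<^sup>2 - 10 * int s \<le> j\<^sup>2"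
  proof (cases "int s \<ge> 5")
    case True
    then have "(int s - 5)\<^sup>2 \<le> j\<^sup>2" using j by (intro power_mono) auto
    then show ?thesis by (simp add: power2_eq_square algebra_simps)
  next
    case False
    then have "int s * int s \<le> 10 * int s" by (intro mult_right_mono) auto
    moreover have "0 \<le> j\<^sup>2" by simp
    ultimately show ?thesis by (simp only: power2_eq_square)
  qed
  ultimately have "\<bar>12 * e\<bar> \<le> 12 * int s + 25"
    using s' unfolding e by (simp add: power2_eq_square algebra_simps abs_le_iff)
  then have "\<bar>e\<bar> \<le> int s + 5" by simp
  moreover have "\<bar>j\<bar> \<le> int s + 5" using j by simp
  moreover have "6 * b \<ge> int w - int s" using b j by simp
  moreover have "(w - 1)\<^sup>2 \<le> 12 * N" "12 * N < w\<^sup>2" using v by (simp_all add: w_def)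
  moreover have "int N = 3 * b\<^sup>2 + j * b + e" by (simp add: e_def)
  ultimately show ?thesis using s2 by blast
qed

section \<open>Dots in a hexagon from a translate of the Sidon set\<close>

lemma pigeonhole_fibre:
  assumes "finite W" "finite C" "f ` W \<subseteq> C" "C \<noteq> {}"
  shows "\<exists>c\<in>C. card W \<le> card C * card {w\<in>W. f w = c}"
proof (rule ccontr)
  assume "\<not> ?thesis"
  then have lt: "card C * card {w\<in>W. f w = c} < card W" if "c \<in> C" for c
    using that by force
  have "card W = (\<Sum>c\<in>C. card {w\<in>W. f w = c})"
    using assms sum.group[of W C f "\<lambda>_. 1::nat"] by simp
  then have "card C * card W = (\<Sum>c\<in>C. card C * card {w\<in>W. f w = c})"
    by (simp add: sum_distrib_left)
  also have "\<dots> < (\<Sum>c\<in>C. card W)"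
    using assms lt by (intro sum_strict_mono) auto
  finally show False by simp
qed

text \<open>The level sets of \<open>f\<close> split the hexagon into \<open>p\<close> classes, each
  the pullback of one translate of the Sidon set, and some class reaches the average size.
  Differences of hexagon points are too short to be nonzero lattice vectors, which gives
  injectivity.\<close>

lemma DD_bar_star_hexagon:
  fixes b j e \<delta> :: int
  assumes p: "prime p"
    and N: "int (p * (p - 1)) = 3 * b\<^sup>2 + j * b + e"
    and small: "\<bar>j\<bar> \<le> \<delta>" "\<bar>e\<bar> \<le> \<delta>" "int R < b - (3 * \<delta> + 3)"
    and r: "2 * R \<le> r"
  shows "\<exists>m A. DD_bar_star m r A \<and> 3 * R\<^sup>2 \<le> p * m"
proof -
  obtain g where g: "residue_primroot p g"
    using prime_primitive_root_exists[OF prime_gt_1_nat[OF p] p] by blast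
  define \<phi> where "\<phi> = (\<lambda>w::int \<times> int. (2 * b + 1) * fst w - b * snd w)"
  define f where "f = (\<lambda>w. (primroot_pow p g (\<phi> w) - \<phi> w) mod int p)"
  have p0: "p > 0" using prime_gt_0_nat[OF p] .
  obtain c where c: "card (hexagon R) \<le> card {0..<int p} * card {w\<in>hexagon R. f w = c}"
    using pigeonhole_fibre[of "hexagon R" "{0..<int p}" f] p0 finite_hexagon
    by (auto simp: f_def image_subset_iff)
  define A where "A = {w\<in>hexagon R. f w = c}"
  have bnd: "\<bar>fst v - fst w\<bar> \<le> 2 * int R" "\<bar>snd v - snd w\<bar> \<le> 2 * int R"
      "\<bar>(fst v - fst w) - (snd v - snd w)\<bar> \<le> 2 * int R"
    if "v \<in> A" "w \<in> A" for v w
    using that by (auto simp: A_def hexagon_def)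
  have diff: "\<phi> (v - w) = \<phi> v - \<phi> w" for v w by (simp add: \<phi>_def algebra_simps)
  have inj: "v = w" if "v \<in> A" "w \<in> A" "int (p * (p - 1)) dvd \<phi> v - \<phi> w" for v w
  proof -
    have "3 * b\<^sup>2 + j * b + e dvd (2 * b + 1) * (fst v - fst w) - b * (snd v - snd w)"
      using that(3) unfolding N by (simp add: \<phi>_def algebra_simps)
    from hex_lattice_min_dist[OF this small(1,2) _ small(3) bnd[OF that(1,2)]]
    show ?thesis by (simp add: prod_eq_iff)
  qed
  have "inj_on (\<lambda>(a, b). a - b) {(a, b). a \<in> A \<and> b \<in> A \<and> a \<noteq> b}"
    by (rule primroot_fibre_distinct_differences[OF p g diff inj, of A c])
       (use p0 in \<open>auto simp: A_def f_def cong_def\<close>)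
  moreover have "hex_dist v w \<le> r" if "v \<in> A" "w \<in> A" for v w
    using bnd[OF that(2,1)] r by (intro hex_dist_le) auto
  moreover have "finite A" using finite_hexagon by (simp add: A_def)
  ultimately have "DD_bar_star (card A) r A" by (simp add: DD_bar_star_def)
  moreover have "3 * R\<^sup>2 \<le> p * card A"
    using card_hexagon_ge[of R] c by (simp add: A_def)
  ultimately show ?thesis by blast
qed

text \<open>Here \<open>6 * b\<close> is about \<open>sqrt 12 * p\<close>, so \<open>b\<close> is
  about \<open>p / sqrt 3\<close>, just above \<open>0.577 * p\<close>. The perturbations cost a
  multiple of \<open>s\<close> plus a constant, and \<open>s \<le> 3 * sqrt p\<close>.\<close>

lemma DD_bar_star_prime:
  assumes p: "prime p" and R: "real R \<le> 0.577 * real p - 11 * sqrt (real p) - 22" "2 * R \<le> r"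
  shows "\<exists>m A. DD_bar_star m r A \<and> 3 * R\<^sup>2 \<le> p * m"
proof -
  obtain b j e :: int and s w :: nat where
    *: "int (p * (p - 1)) = 3 * b\<^sup>2 + j * b + e" "\<bar>j\<bar> \<le> int s + 5" "\<bar>e\<bar> \<le> int s + 5"
      "6 * b \<ge> int w - int s" "s\<^sup>2 \<le> 2 * w" "12 * (p * (p - 1)) < w\<^sup>2" "(w - 1)\<^sup>2 \<le> 12 * (p * (p - 1))"
    using hex_form_approx[of "p * (p - 1)"] by blast
  have p1: "p > 1" using prime_gt_1_nat[OF p] .
  have "(w - 1)\<^sup>2 \<le> (4 * p)\<^sup>2"
  proof -
    have "(w - 1)\<^sup>2 \<le> 12 * (p * p)" using *(7) by (rule order_trans) (intro mult_le_mono order_refl diff_le_self)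
    also have "\<dots> \<le> (4 * p)\<^sup>2" by (simp add: power2_eq_square)
    finally show ?thesis .
  qed
  then have "w - 1 \<le> 4 * p" by (metis power2_le_imp_le le0)
  then have "s\<^sup>2 \<le> 9 * p" using *(5) p1 by simp
  then have "(real s)\<^sup>2 \<le> 9 * real p" by (metis of_nat_le_iff of_nat_mult of_nat_numeral of_nat_power)
  then have s: "real s \<le> 3 * sqrt (real p)"
    using real_le_rsqrt[of "real s" "9 * real p"] by (simp add: real_sqrt_mult)
  have w: "3.464 * (real p - 1) \<le> real w"
  proof (rule power2_le_imp_le)
    have "(3.464 * (real p - 1))\<^sup>2 \<le> 12 * ((real p - 1) * (real p - 1))"
      unfolding power_mult_distrib power2_eq_square[of "real p - 1"]
      by (intro mult_right_mono) (simp_all add: power2_eq_square)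
    also have "\<dots> \<le> 12 * (real p * (real p - 1))"
      using p1 by (intro mult_left_mono mult_right_mono) auto
    also have "\<dots> = real (12 * (p * (p - 1)))" using p1 by (simp add: of_nat_diff)
    also have "\<dots> \<le> (real w)\<^sup>2" using *(6) by (metis less_imp_le of_nat_le_iff of_nat_power)
    finally show "(3.464 * (real p - 1))\<^sup>2 \<le> (real w)\<^sup>2" .
  qed simp
  have "6 * real_of_int b \<ge> real w - real s"
    using *(4) by linarith
  then have "real R < real_of_int b - (3 * (real s + 5) + 3)"
    using R(1) s w p1 by simp
  then have "real_of_int (int R) < real_of_int (b - (3 * (int s + 5) + 3))"
    by simp
  then have "int R < b - (3 * (int s + 5) + 3)"
    by (simp only: of_int_less_iff)
  from DD_bar_star_hexagon[OF p *(1-3) this R(2)] show ?thesis .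
qed

section \<open>Primes in short intervals\<close>

lemma real_div_le_Suc: "real n / real k - real (n div k) \<le> 1"
proof (cases "k = 0")
  case False
  have "real n = real (n div k) * real k + real (n mod k)"
    by (metis of_nat_add of_nat_mult div_mult_mod_eq)
  moreover have "real (n mod k) \<le> real k" using False by simp
  ultimately show ?thesis using False by (simp add: field_simps)
qed simp

section \<open>Chebyshev's function and factorials\<close>

definition chebyshev_psi :: "nat \<Rightarrow> real" where
  "chebyshev_psi n = (\<Sum>d=1..n. mangoldt d)"

lemma chebyshev_psi_mono: "m \<le> n \<Longrightarrow> chebyshev_psi m \<le> chebyshev_psi n"
  unfolding chebyshev_psi_def by (intro sum_mono2) (auto simp: mangoldt_nonneg)

lemma chebyshev_psi_nonneg: "0 \<le> chebyshev_psi n"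
  unfolding chebyshev_psi_def by (intro sum_nonneg) (simp add: mangoldt_nonneg)

text \<open>The condition \<open>d \<le> n div k\<close> amounts to \<open>k \<le> n div d\<close>.
  With all sums running over \<open>d \<le> n\<close>, combinations can be compared coefficient by
  coefficient.\<close>

lemma chebyshev_psi_div:
  assumes "k > 0"
  shows "chebyshev_psi (n div k) = (\<Sum>d=1..n. mangoldt d * of_bool (k \<le> n div d))"
proof -
  have "chebyshev_psi (n div k) = (\<Sum>d=1..n div k. mangoldt d * of_bool (k \<le> n div d))"
    unfolding chebyshev_psi_def using assms
    by (intro sum.cong refl) (auto simp: less_eq_div_iff_mult_less_eq mult.commute)
  also have "\<dots> = (\<Sum>d=1..n. mangoldt d * of_bool (k \<le> n div d))"
    using assms
    by (intro sum.mono_neutral_left)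
       (auto simp: less_eq_div_iff_mult_less_eq mult.commute intro: order_trans[OF _ div_le_dividend])
  finally show ?thesis .
qed

text \<open>Passing from \<open>n\<close> to \<open>n + 1\<close> raises \<open>n div d\<close> by
  one exactly for the divisors \<open>d\<close> of \<open>n + 1\<close>, and their
  \<open>mangoldt\<close> values sum to \<open>ln (n + 1)\<close>.\<close>

lemma ln_fact_eq_sum_mangoldt:
  "ln (fact n) = (\<Sum>d=1..n. mangoldt d * real (n div d))"
proof (induction n)
  case (Suc n)
  have "ln (fact (Suc n)) = ln (real (Suc n)) + ln (fact n :: real)"
    by (simp add: ln_mult del: of_nat_Suc)
  also have "ln (fact n) = (\<Sum>d=1..Suc n. mangoldt d * real (n div d))"
    using Suc by simp
  also have "ln (real (Suc n)) = (\<Sum>d | d dvd Suc n. mangoldt d)"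
    using mangoldt_sum[of "Suc n", where ?'a = real] by simp
  also have "\<dots> = (\<Sum>d=1..Suc n. mangoldt d * of_bool (d dvd Suc n))"
    by (rule sum.mono_neutral_cong_left) (auto dest: dvd_imp_le intro!: Suc_leI Nat.gr0I)
  also have "\<dots> + (\<Sum>d=1..Suc n. mangoldt d * real (n div d)) =
      (\<Sum>d=1..Suc n. mangoldt d * real (Suc n div d))"
    unfolding sum.distrib[symmetric]
    by (intro sum.cong refl) (simp add: div_Suc dvd_eq_mod_eq_0 algebra_simps)
  finally show ?case .
qed simp

lemma ln_fact_div_eq_sum_mangoldt:
  assumes "k > 0"
  shows "ln (fact (n div k)) = (\<Sum>d=1..n. mangoldt d * real (n div d div k))"
proof -
  have "ln (fact (n div k)) = (\<Sum>d=1..n div k. mangoldt d * real (n div k div d))"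
    by (rule ln_fact_eq_sum_mangoldt)
  also have "\<dots> = (\<Sum>d=1..n. mangoldt d * real (n div k div d))"
    by (intro sum.mono_neutral_left) (auto intro: order_trans[OF _ div_le_dividend])
  also have "\<dots> = (\<Sum>d=1..n. mangoldt d * real (n div d div k))"
    by (simp add: div_mult2_eq[symmetric] mult.commute)
  finally show ?thesis .
qed

text \<open>Chebyshev's choice: as \<open>1 - 1/2 - 1/3 - 1/5 + 1/30 = 0\<close>, the
  \<open>n * ln n\<close> terms cancel, and the coefficients of \<open>mangoldt\<close> are only 0
  and 1.\<close>

definition chebyshev_S :: "nat \<Rightarrow> real" where
  "chebyshev_S n = ln (fact n) - ln (fact (n div 2)) - ln (fact (n div 3)) - ln (fact (n div 5))
     + ln (fact (n div 30))"

definition chebyshev_E :: "nat \<Rightarrow> int" where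
  "chebyshev_E m = int m - int (m div 2) - int (m div 3) - int (m div 5) + int (m div 30)"

lemma chebyshev_S_eq:
  "chebyshev_S n = (\<Sum>d=1..n. mangoldt d * real_of_int (chebyshev_E (n div d)))"
  unfolding chebyshev_S_def ln_fact_eq_sum_mangoldt[of n]
  by (simp add: ln_fact_div_eq_sum_mangoldt chebyshev_E_def sum.distrib sum_subtractf algebra_simps)

text \<open>The function has period 30, so evaluation on one period decides. The lower bound is
  exact for \<open>m < 10\<close>, with the only zeros 0 and 6 there, and equals 0 from 10
  on.\<close>

lemma chebyshev_E_bounds:
  shows "chebyshev_E m \<le> of_bool (1 \<le> m)"
    and "of_bool (1 \<le> m) - of_bool (6 \<le> m) + of_bool (7 \<le> m) - of_bool (10 \<le> m) \<le> chebyshev_E m"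
proof -
  define q t where "q = m div 30" and "t = m mod 30"
  have m: "m = 30 * q + t" and "t < 30" by (simp_all add: q_def t_def)
  have E: "chebyshev_E m = chebyshev_E t"
  proof -
    have "m div 2 = 15 * q + t div 2" "m div 3 = 10 * q + t div 3" "m div 5 = 6 * q + t div 5"
      "m div 30 = q + t div 30"
      unfolding m by (simp_all add: div_add1_eq[of "30 * q"])
    then show ?thesis unfolding chebyshev_E_def by (simp add: m)
  qed
  have "\<forall>t\<in>set [0..<30]. chebyshev_E t \<le> of_bool (1 \<le> t) \<and> 0 \<le> chebyshev_E t \<and>
      of_bool (1 \<le> t) - of_bool (6 \<le> t) + of_bool (7 \<le> t) - of_bool (10 \<le> t) \<le> chebyshev_E t"
    by code_simp
  moreover have "t \<in> set [0..<30]" using \<open>t < 30\<close> by simp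
  ultimately have E1: "chebyshev_E t \<le> of_bool (1 \<le> t)" and E0: "0 \<le> chebyshev_E t"
    and E2: "of_bool (1 \<le> t) - of_bool (6 \<le> t) + of_bool (7 \<le> t) - of_bool (10 \<le> t) \<le> chebyshev_E t"
    by blast+
  show "chebyshev_E m \<le> of_bool (1 \<le> m)"
    using E1 unfolding E by (cases "t = 0") (auto simp: m)
  show "of_bool (1 \<le> m) - of_bool (6 \<le> m) + of_bool (7 \<le> m) - of_bool (10 \<le> m) \<le> chebyshev_E m"
  proof (cases "q = 0")
    case True
    then show ?thesis using E2 unfolding E by (simp add: m)
  next
    case False
    then have "10 \<le> m" using m by simp
    then show ?thesis using E0 unfolding E by simp
  qed
qed

lemma chebyshev_S_le: "chebyshev_S n \<le> chebyshev_psi n"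
  unfolding chebyshev_S_eq chebyshev_psi_def
proof (rule sum_mono)
  fix d
  have "real_of_int (chebyshev_E (n div d)) \<le> 1"
    using chebyshev_E_bounds(1)[of "n div d"] by (cases "1 \<le> n div d") auto
  then show "mangoldt d * real_of_int (chebyshev_E (n div d)) \<le> mangoldt d"
    by (simp add: mangoldt_nonneg mult_left_le)
qed

lemma chebyshev_S_ge:
  "chebyshev_psi n - chebyshev_psi (n div 6) + chebyshev_psi (n div 7) - chebyshev_psi (n div 10)
    \<le> chebyshev_S n"
proof -
  have 1: "chebyshev_psi n = (\<Sum>d=1..n. mangoldt d * of_bool (1 \<le> n div d))"
    using chebyshev_psi_div[of 1 n] by simp
  have "chebyshev_psi n - chebyshev_psi (n div 6) + chebyshev_psi (n div 7) - chebyshev_psi (n div 10)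
     = (\<Sum>d=1..n. mangoldt d * real_of_int (of_bool (1 \<le> n div d) - of_bool (6 \<le> n div d)
          + of_bool (7 \<le> n div d) - of_bool (10 \<le> n div d)))"
    unfolding 1 by (simp add: chebyshev_psi_div sum.distrib sum_subtractf algebra_simps)
  also have "\<dots> \<le> chebyshev_S n"
    unfolding chebyshev_S_eq
    by (intro sum_mono mult_left_mono mangoldt_nonneg of_int_le_iff[THEN iffD2] chebyshev_E_bounds(2))
  finally show ?thesis .
qed

section \<open>Stirling-type bounds\<close>

text \<open>Both follow from \<open>ln x \<le> x - 1\<close>; they are the induction steps of the
  two factorial bounds below.\<close>

lemma ln_Suc_diff_bounds:
  assumes "n > 0"
  shows "1 \<le> (real n + 1) * (ln (real n + 1) - ln (real n))"
    and "real n * (ln (real n + 1) - ln (real n)) \<le> 1"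
proof -
  have "ln (real n / (real n + 1)) \<le> real n / (real n + 1) - 1"
    using assms by (intro ln_le_minus_one) auto
  then have "1 - real n / (real n + 1) \<le> ln (real n + 1) - ln (real n)"
    using assms by (simp add: ln_div)
  then show "1 \<le> (real n + 1) * (ln (real n + 1) - ln (real n))"
    by (simp add: field_simps)
  have "ln ((real n + 1) / real n) \<le> (real n + 1) / real n - 1"
    using assms by (intro ln_le_minus_one) auto
  then show "real n * (ln (real n + 1) - ln (real n)) \<le> 1"
    using assms by (simp add: ln_div field_simps)
qed

lemma ln_fact_ge: "n > 0 \<Longrightarrow> real n * ln (real n) - real n + 1 \<le> ln (fact n)"
proof (induction n rule: nat_induct_non_zero)
  case (Suc n)
  have "ln (fact (Suc n)) = ln (real n + 1) + ln (fact n :: real)"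
    by (simp add: ln_mult add.commute)
  then show ?case
    using Suc ln_Suc_diff_bounds(2)[OF Suc.hyps] by (simp add: algebra_simps)
qed simp

lemma ln_fact_le: "n > 0 \<Longrightarrow> ln (fact n) \<le> real n * ln (real n) - real n + ln (real n) + 1"
proof (induction n rule: nat_induct_non_zero)
  case (Suc n)
  have "ln (fact (Suc n)) = ln (real n + 1) + ln (fact n :: real)"
    by (simp add: ln_mult add.commute)
  then show ?case
    using Suc ln_Suc_diff_bounds(1)[OF Suc.hyps] by (simp add: algebra_simps)
qed simp

lemma x_ln_x_minus_x_mono:
  fixes x y :: real
  assumes "1 \<le> x" "x \<le> y"
  shows "x * ln x - x \<le> y * ln y - y"
proof -
  have "ln (x / y) \<le> x / y - 1" using assms by (intro ln_le_minus_one) auto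
  then have "y * (ln x - ln y) \<le> x - y" using assms by (simp add: ln_div field_simps)
  moreover have "0 \<le> (y - x) * ln x" using assms by simp
  ultimately show ?thesis by (simp add: algebra_simps)
qed

text \<open>With \<open>m = n div k\<close> one has \<open>m \<le> x \<le> m + 1\<close>, and
  \<open>x * ln x - x\<close> is increasing. The lower bound passes through \<open>(m + 1)!\<close>,
  at the cost of \<open>ln (m + 1)\<close>.\<close>

lemma ln_fact_div_approx:
  assumes k: "k > 0" "k \<le> n"
  defines "x \<equiv> real n / real k"
  shows "\<bar>ln (fact (n div k)) - (x * ln x - x)\<bar> \<le> ln (real n + 1) + 1"
proof -
  define m where "m = n div k"
  have m1: "m \<ge> 1" using k by (simp add: m_def Suc_le_eq div_greater_zero_iff)
  have mx: "real m \<le> x" unfolding m_def x_def by (rule of_nat_div_le_of_nat)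
  have xm: "x \<le> real m + 1"
    using real_div_le_Suc[of n k] by (simp add: m_def x_def)
  have xn: "x \<le> real n" using k by (simp add: x_def field_simps)
  have "ln (fact m) \<le> real m * ln (real m) - real m + ln (real m) + 1"
    using m1 by (intro ln_fact_le) auto
  also have "\<dots> \<le> x * ln x - x + ln (real n + 1) + 1"
    using x_ln_x_minus_x_mono[of "real m" x] m1 mx xn by (intro add_mono) auto
  finally have 1: "ln (fact m) - (x * ln x - x) \<le> ln (real n + 1) + 1" by simp
  have "x * ln x - x \<le> (real m + 1) * ln (real m + 1) - (real m + 1)"
    using m1 mx xm by (intro x_ln_x_minus_x_mono) auto
  also have "\<dots> \<le> ln (fact (Suc m))"
    using ln_fact_ge[of "Suc m"] by (simp add: add.commute)
  also have "\<dots> = ln (real m + 1) + ln (fact m :: real)"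
    by (simp add: ln_mult add.commute)
  also have "ln (real m + 1) \<le> ln (real n + 1)"
    by (simp add: m_def)
  finally show ?thesis using 1 ln_ge_zero[of "real n + 1"] unfolding m_def by (simp add: abs_le_iff)
qed

text \<open>The limit of \<open>chebyshev_S n / n\<close>, about 0.9213.\<close>

definition chebyshev_A :: real where
  "chebyshev_A = ln 2 / 2 + ln 3 / 3 + ln 5 / 5 - ln 30 / 30"

lemma chebyshev_A_pos: "chebyshev_A > 0"
proof -
  have "ln (30::real) = ln 2 + ln 3 + ln 5"
    using ln_mult_pos[of "2::real" 15] ln_mult_pos[of "3::real" 5] by simp
  moreover have "ln (2::real) > 0" "ln (3::real) > 0" "ln (5::real) > 0" by simp_all
  ultimately show ?thesis unfolding chebyshev_A_def by linarith
qed

lemma chebyshev_S_approx: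
  assumes "n \<ge> 30"
  shows "\<bar>chebyshev_S n - chebyshev_A * real n\<bar> \<le> 5 * (ln (real n + 1) + 1)"
proof -
  define T where "T = (\<lambda>k::nat. let x = real n / real k in x * ln x - x)"
  define L where "L = ln (real n + 1) + 1"
  have T: "\<bar>ln (fact (n div k)) - T k\<bar> \<le> L" if "k \<in> {1, 2, 3, 5, 30}" for k
    using ln_fact_div_approx[of k n] that assms unfolding T_def L_def Let_def by force
  have tri: "\<bar>a - b - c - d + e\<bar> \<le> 5 * L"
    if "\<bar>a\<bar> \<le> L" "\<bar>b\<bar> \<le> L" "\<bar>c\<bar> \<le> L" "\<bar>d\<bar> \<le> L" "\<bar>e\<bar> \<le> L" for a b c d e :: real
    using that unfolding abs_le_iff by linarith
  have "T 1 - T 2 - T 3 - T 5 + T 30 = chebyshev_A * real n"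
    using assms by (simp add: T_def chebyshev_A_def ln_div field_simps)
  moreover have "chebyshev_S n - (T 1 - T 2 - T 3 - T 5 + T 30) =
      (ln (fact (n div 1)) - T 1) - (ln (fact (n div 2)) - T 2) - (ln (fact (n div 3)) - T 3)
      - (ln (fact (n div 5)) - T 5) + (ln (fact (n div 30)) - T 30)"
    by (simp add: chebyshev_S_def)
  moreover have "\<bar>(ln (fact (n div 1)) - T 1) - (ln (fact (n div 2)) - T 2) - (ln (fact (n div 3)) - T 3)
      - (ln (fact (n div 5)) - T 5) + (ln (fact (n div 30)) - T 30)\<bar> \<le> 5 * L"
    by (rule tri[OF T[of 1] T[of 2] T[of 3] T[of 5] T[of 30]]) simp_all
  ultimately show ?thesis
    unfolding L_def[symmetric] by (simp only:)
qed

lemma eventually_chebyshev_S: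
  assumes "\<epsilon> > 0"
  shows "\<forall>\<^sub>F n in at_top. \<bar>chebyshev_S n - chebyshev_A * real n\<bar> \<le> \<epsilon> * real n"
proof -
  have "\<forall>\<^sub>F n in at_top. 5 * (ln (real n + 1) + 1) \<le> \<epsilon> * real n"
    using assms by real_asymp
  then show ?thesis
    using eventually_ge_at_top[of 30]
    by eventually_elim (use chebyshev_S_approx in force)
qed

section \<open>Upper and lower bounds for psi\<close>

text \<open>Iterating along \<open>n\<close>, \<open>n / 6\<close>, \<open>n / 36\<close> sums the
  geometric series \<open>c * (1 + 1/6 + 1/36 + ...) = 6/5 * c\<close>; \<open>K\<close> absorbs the
  small \<open>n\<close>.\<close>

lemma chebyshev_psi_le_of_div_6:
  assumes ev: "\<forall>\<^sub>F n in at_top. chebyshev_psi n - chebyshev_psi (n div 6) \<le> c * real n"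
    and c: "c \<ge> 0"
  shows "\<exists>K\<ge>0. \<forall>n. chebyshev_psi n \<le> K + 6 / 5 * c * real n"
proof -
  obtain n0 where n0: "\<And>n. n \<ge> n0 \<Longrightarrow> chebyshev_psi n - chebyshev_psi (n div 6) \<le> c * real n"
    using ev by (auto simp: eventually_at_top_linorder)
  define K where "K = chebyshev_psi n0"
  have "chebyshev_psi n \<le> K + 6 / 5 * c * real n" for n
  proof (induction n rule: less_induct)
    case (less n)
    show ?case
    proof (cases "n \<ge> n0 \<and> n > 0")
      case True
      have "chebyshev_psi n \<le> chebyshev_psi (n div 6) + c * real n"
        using n0[of n] True by simp
      also have "\<dots> \<le> (K + 6 / 5 * c * real (n div 6)) + c * real n"
        using less[of "n div 6"] True by simp
      also have "\<dots> \<le> (K + 6 / 5 * c * (real n / 6)) + c * real n"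
        using c of_nat_div_le_of_nat[where ?'a = real, of n 6] by (intro add_mono mult_left_mono) auto
      finally show ?thesis by simp
    next
      case False
      then have "chebyshev_psi n \<le> K"
        unfolding K_def by (intro chebyshev_psi_mono) auto
      then show ?thesis using c by (simp add: add_increasing2)
    qed
  qed
  then show ?thesis using chebyshev_psi_nonneg[of n0] unfolding K_def by blast
qed

text \<open>Chebyshev's \<open>\<psi>(n) \<le> 6/5 A n + o(n)\<close> is fed back once, through the terms
  \<open>\<psi>(n/7) - \<psi>(n/10)\<close> that his argument discards: without them the ratio of the upper
  to the lower bound is \<open>6/5\<close>, while the theorem tolerates at most \<open>3 / \<mu>\<^sup>2 \<approx> 1.188\<close>.\<close>

lemma chebyshev_psi_bounds:
  shows "\<forall>\<^sub>F n in at_top. 0.9999 * chebyshev_A * real n \<le> chebyshev_psi n"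
    and "\<exists>K. \<forall>n. chebyshev_psi n \<le> K + 1.173 * chebyshev_A * real n"
proof -
  define \<epsilon> where "\<epsilon> = chebyshev_A / 10000"
  have \<epsilon>: "\<epsilon> > 0" and A: "chebyshev_A = 10000 * \<epsilon>"
    using chebyshev_A_pos by (simp_all add: \<epsilon>_def)
  note S = eventually_chebyshev_S[OF \<epsilon>, unfolded A]
  from S show lower: "\<forall>\<^sub>F n in at_top. 0.9999 * chebyshev_A * real n \<le> chebyshev_psi n"
    by eventually_elim (use chebyshev_S_le in \<open>fastforce simp: A abs_le_iff algebra_simps intro: order_trans\<close>)
  have "\<forall>\<^sub>F n in at_top. chebyshev_psi n - chebyshev_psi (n div 6) \<le> 10001 * \<epsilon> * real n"
    using S
  proof eventually_elim
    case (elim n)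
    have "chebyshev_psi (n div 10) \<le> chebyshev_psi (n div 7)"
      by (intro chebyshev_psi_mono div_le_mono2) auto
    then show ?case using elim chebyshev_S_ge[of n] by (simp add: abs_le_iff algebra_simps)
  qed
  from chebyshev_psi_le_of_div_6[OF this] \<epsilon> obtain K where
    K: "\<And>n. chebyshev_psi n \<le> K + 6 / 5 * (10001 * \<epsilon>) * real n" by auto
  have "filterlim (\<lambda>n::nat. n div 7) at_top at_top"
    by (rule filterlim_at_top_div_const_nat) simp
  from eventually_compose_filterlim[OF lower this]
  have lower7: "\<forall>\<^sub>F n in at_top. 0.9999 * chebyshev_A * real (n div 7) \<le> chebyshev_psi (n div 7)" .
  have "\<forall>\<^sub>F n in at_top. K + 9999 * \<epsilon> \<le> \<epsilon> * real n"
    using \<epsilon> by real_asymp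
  with S lower7
  \<comment> \<open>In units of \<open>\<epsilon> * n\<close> the bound is
    \<open>10001 - 9999 / 7 + 6 / 5 * 10001 / 10 + 1 < 9774.5\<close>, the last 1 covering the
    constants. Then \<open>6 / 5 * 9774.5 < 11730\<close> yields the factor 1.173.\<close>
  have "\<forall>\<^sub>F n in at_top. chebyshev_psi n - chebyshev_psi (n div 6) \<le> 9774.5 * \<epsilon> * real n"
  proof eventually_elim
    case (elim n)
    have "real n / 7 - 1 \<le> real (n div 7)"
      using real_div_le_Suc[of n 7] by simp
    then have "9999 * \<epsilon> * (real n / 7 - 1) \<le> 9999 * \<epsilon> * real (n div 7)"
      using \<epsilon> by (intro mult_left_mono) auto
    then have 7: "9999 * \<epsilon> * (real n / 7 - 1) \<le> chebyshev_psi (n div 7)"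
      using elim(2) by (simp add: A)
    have "6 / 5 * (10001 * \<epsilon>) * real (n div 10) \<le> 6 / 5 * (10001 * \<epsilon>) * (real n / 10)"
      using \<epsilon> of_nat_div_le_of_nat[where ?'a = real, of n 10] by (intro mult_left_mono) auto
    then have 10: "chebyshev_psi (n div 10) \<le> K + 6 / 5 * (10001 * \<epsilon>) * (real n / 10)"
      using K[of "n div 10"] by linarith
    have pos: "\<epsilon> * real n \<ge> 0" using \<epsilon> by simp
    show ?case
      using chebyshev_S_ge[of n] 7 10 elim(1,3) pos by (simp add: abs_le_iff algebra_simps)
  qed
  from chebyshev_psi_le_of_div_6[OF this] \<epsilon> obtain K' where
    K': "\<And>n. chebyshev_psi n \<le> K' + 6 / 5 * (9774.5 * \<epsilon>) * real n" by auto
  have "chebyshev_psi n \<le> K' + 1.173 * chebyshev_A * real n" for n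
  proof -
    have "\<epsilon> * real n \<ge> 0" using \<epsilon> by simp
    then show ?thesis using K'[of n] by (simp add: A algebra_simps)
  qed
  then show "\<exists>K. \<forall>n. chebyshev_psi n \<le> K + 1.173 * chebyshev_A * real n" by blast
qed

section \<open>From psi to primes\<close>

text \<open>Only powers \<open>q^k\<close> with \<open>k \<ge> 2\<close> contribute, so
  \<open>q \<le> sqrt y\<close> and \<open>k \<le> log 2 y\<close>, and each contributes at most
  \<open>ln y\<close>.\<close>

lemma chebyshev_psi_diff_no_prime:
  assumes "x \<le> y" "y > 0" and no_prime: "\<And>p. prime p \<Longrightarrow> x < p \<Longrightarrow> p \<le> y \<Longrightarrow> False"
  shows "chebyshev_psi y - chebyshev_psi x \<le> sqrt (real y) * (log 2 (real y) + 1) * ln (real y)"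
proof -
  define P where "P = {d\<in>{x<..y}. primepow d}"
  define L where "L = nat \<lfloor>log 2 (real y)\<rfloor>"
  have log0: "log 2 (real y) \<ge> 0" using assms by simp
  have "P \<subseteq> (\<lambda>(q, k). q ^ k) ` ({1..floor_sqrt y} \<times> {..L})"
  proof
    fix d assume "d \<in> P"
    then have d: "x < d" "d \<le> y" "primepow d" by (auto simp: P_def)
    obtain q k where qk: "prime q" "k > 0" "d = q ^ k"
      using d(3) by (auto simp: primepow_def)
    have "k \<noteq> 1" using no_prime[of q] qk d by auto
    then have "q ^ 2 \<le> q ^ k" using qk prime_gt_0_nat[of q] by (intro power_increasing) auto
    then have "q \<le> floor_sqrt y" using d qk by (simp add: le_floor_sqrt_iff)
    moreover have "k \<le> L"
    proof -
      have "2 ^ k \<le> q ^ k" using prime_ge_2_nat[OF qk(1)] by (intro power_mono) auto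
      then have "2 ^ k \<le> y" using d(2) unfolding qk(3) by (rule order_trans)
      then have "real k \<le> log 2 (real y)"
        by (metis le_log2_of_power)
      then show ?thesis by (simp add: L_def le_nat_floor)
    qed
    moreover have "1 \<le> q" using prime_gt_0_nat[OF qk(1)] by simp
    ultimately show "d \<in> (\<lambda>(q, k). q ^ k) ` ({1..floor_sqrt y} \<times> {..L})"
      using qk by force
  qed
  then have "card P \<le> card ({1..floor_sqrt y} \<times> {..L})"
    by (rule surj_card_le[rotated]) simp
  then have "card P \<le> floor_sqrt y * (L + 1)" by simp
  then have "real (card P) \<le> real (floor_sqrt y) * (real L + 1)"
    by (metis of_nat_1 of_nat_add of_nat_le_iff of_nat_mult)
  also have "\<dots> \<le> sqrt (real y) * (log 2 (real y) + 1)"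
  proof (intro mult_mono)
    have "(real (floor_sqrt y))\<^sup>2 \<le> real y"
      by (metis floor_sqrt_power2_le of_nat_le_iff of_nat_power)
    then show "real (floor_sqrt y) \<le> sqrt (real y)" by (rule real_le_rsqrt)
    show "real L + 1 \<le> log 2 (real y) + 1" using log0 by (simp add: L_def)
  qed auto
  finally have cardP: "real (card P) \<le> sqrt (real y) * (log 2 (real y) + 1)" .
  have "chebyshev_psi y = chebyshev_psi x + (\<Sum>d\<in>{x<..y}. mangoldt d)"
  proof -
    have "{1..y} = {1..x} \<union> {x<..y}" using assms(1) by auto
    then show ?thesis
      unfolding chebyshev_psi_def by (simp add: sum.union_disjoint[symmetric] ivl_disj_int)
  qed
  then have "chebyshev_psi y - chebyshev_psi x = (\<Sum>d\<in>{x<..y}. mangoldt d)" by simp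
  also have "\<dots> = (\<Sum>d\<in>P. mangoldt d)"
    unfolding P_def by (rule sum.mono_neutral_right) (auto simp: mangoldt_def)
  also have "\<dots> \<le> (\<Sum>d\<in>P. ln (real y))"
  proof (rule sum_mono)
    fix d assume "d \<in> P"
    then have d: "0 < d" "d \<le> y" by (auto simp: P_def)
    then have "mangoldt d \<le> ln (real d)" by (intro mangoldt_le) auto
    also have "\<dots> \<le> ln (real y)" using d by simp
    finally show "mangoldt d \<le> ln (real y)" .
  qed
  also have "\<dots> = real (card P) * ln (real y)" by simp
  also have "\<dots> \<le> sqrt (real y) * (log 2 (real y) + 1) * ln (real y)"
    using cardP assms by (intro mult_right_mono) auto
  finally show ?thesis .
qed

text \<open>Since \<open>0.9999 * 1.175 - 1.173 = 0.0018825 > 0\<close>, psi grows linearly in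
  \<open>n\<close> across the interval, more than proper prime powers can account for.\<close>

lemma eventually_prime_between:
  "\<forall>\<^sub>F n in at_top. \<exists>p. prime p \<and> n < p \<and> real p \<le> 1.175 * real n"
proof -
  obtain K where K: "\<And>n. chebyshev_psi n \<le> K + 1.173 * chebyshev_A * real n"
    using chebyshev_psi_bounds(2) by blast
  define Y where "Y = (\<lambda>n::nat. nat \<lfloor>1.175 * real n\<rfloor>)"
  have "filterlim Y at_top at_top" unfolding Y_def by real_asymp
  from eventually_compose_filterlim[OF chebyshev_psi_bounds(1) this]
  have lower: "\<forall>\<^sub>F n in at_top. 0.9999 * chebyshev_A * real (Y n) \<le> chebyshev_psi (Y n)" .
  have small: "\<forall>\<^sub>F n in at_top. sqrt (2 * real n) * (log 2 (2 * real n) + 1) * ln (2 * real n)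
      + chebyshev_A + K < chebyshev_A * (0.001 * real n)"
    using chebyshev_A_pos by real_asymp
  show ?thesis
    using lower small eventually_gt_at_top[of 0]
  proof eventually_elim
    case (elim n)
    show ?case
    proof (rule ccontr)
      assume contra: "\<not> ?thesis"
      have Yle: "real (Y n) \<le> 1.175 * real n" unfolding Y_def by (rule of_nat_floor) simp
      have "real (Y n) = real_of_int \<lfloor>1.175 * real n\<rfloor>" unfolding Y_def by (rule of_nat_nat) simp
      then have Yge: "1.175 * real n - 1 \<le> real (Y n)" by linarith
      have nY: "n \<le> Y n" unfolding Y_def by (simp add: le_nat_floor)
      define B where "B = sqrt (2 * real n) * (log 2 (2 * real n) + 1) * ln (2 * real n)"
      have "False" if "prime p" "n < p" "p \<le> Y n" for p
        using contra that Yle by (meson of_nat_le_iff order_trans)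
      from chebyshev_psi_diff_no_prime[OF nY _ this] elim nY
      have "chebyshev_psi (Y n) - chebyshev_psi n
          \<le> sqrt (real (Y n)) * (log 2 (real (Y n)) + 1) * ln (real (Y n))" by simp
      also have "\<dots> \<le> sqrt (2 * real n) * (log 2 (2 * real n) + 1) * ln (2 * real n)"
        using Yle nY elim(3) by (intro mult_mono add_mono) auto
      finally have up: "chebyshev_psi (Y n) - chebyshev_psi n
          \<le> sqrt (2 * real n) * (log 2 (2 * real n) + 1) * ln (2 * real n)" .
      have "0.9999 * chebyshev_A * (1.175 * real n - 1) \<le> 0.9999 * chebyshev_A * real (Y n)"
        using Yge chebyshev_A_pos by (intro mult_left_mono) auto
      then have ge: "0.9999 * chebyshev_A * (1.175 * real n - 1) - (K + 1.173 * chebyshev_A * real n)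
          \<le> chebyshev_psi (Y n) - chebyshev_psi n"
        using elim(1) K[of n] by linarith
      have eq: "0.9999 * chebyshev_A * (1.175 * real n - 1) - (K + 1.173 * chebyshev_A * real n)
          = 0.0018825 * (chebyshev_A * real n) - 0.9999 * chebyshev_A - K"
        by (simp add: field_simps)
      have "0.0018825 * (chebyshev_A * real n) - 0.9999 * chebyshev_A - K \<le> B"
        using ge up unfolding eq B_def by (rule order_trans)
      moreover have "B + chebyshev_A + K < 0.001 * (chebyshev_A * real n)"
        using elim(2) by (simp add: B_def)
      moreover have "chebyshev_A * real n \<ge> 0" using chebyshev_A_pos by simp
      moreover have False if "0.0018825 * X - 0.9999 * a - k \<le> b" "b + a + k < 0.001 * X" "X \<ge> 0" "a > 0"
        for X a k b :: real
        using that by simp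
      ultimately show False
        using chebyshev_A_pos by blast
    qed
  qed
qed

section \<open>The constant and the theorem\<close>

text \<open>The positive root of \<open>3 * a^2 + 2 * a - 2\<close>, where the derivative of
  \<open>mu_fun\<close> vanishes.\<close>

definition mu_arg :: real where "mu_arg = (sqrt 7 - 1) / 3"

lemma mu_arg_pos: "mu_arg > 0"
  by (simp add: mu_arg_def)

text \<open>With \<open>t = sqrt (1 + a)\<close> the function becomes the concave \<open>(4t - t\<^sup>3 - 1/t) / sqrt 2\<close>.\<close>

lemma mu_fun_eq:
  assumes "t > 0"
  shows "mu_fun (t\<^sup>2 - 1) = (4 * t - t ^ 3 - 1 / t) / sqrt 2"
  using assms by (simp add: mu_fun_def field_simps power2_eq_square power3_eq_cube)

lemma mu_fun_le:
  assumes "a > 0"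
  shows "mu_fun a \<le> mu_fun mu_arg"
proof -
  define t u where "t = sqrt (1 + a)" and "u = sqrt (1 + mu_arg)"
  have pos: "t > 0" "u > 0" using assms mu_arg_pos by (simp_all add: t_def u_def)
  have t: "a = t\<^sup>2 - 1" and u: "mu_arg = u\<^sup>2 - 1"
    using assms mu_arg_pos by (simp_all add: t_def u_def)
  have "3 * mu_arg\<^sup>2 + 2 * mu_arg - 2 = 0"
    by (simp add: mu_arg_def power2_eq_square field_simps)
  then have crit: "3 * u ^ 4 = 4 * u\<^sup>2 + 1"
    unfolding u by (simp add: power2_eq_square power4_eq_xxxx algebra_simps)
  \<comment> \<open>Expansion about \<open>u\<close>: two nonnegative remainders from concavity, and
    a linear term that vanishes at the critical point.\<close>
  have "4 * u - u ^ 3 - 1 / u - (4 * t - t ^ 3 - 1 / t)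
      = (t - u)\<^sup>2 * (t + 2 * u) + (t - u)\<^sup>2 / (t * u\<^sup>2) + (t - u) * (3 * u ^ 4 - 4 * u\<^sup>2 - 1) / u\<^sup>2"
    using pos by (simp add: field_simps power2_eq_square power3_eq_cube power4_eq_xxxx)
  also have "\<dots> \<ge> 0"
    using pos crit by simp
  finally show ?thesis
    unfolding t u using pos by (simp add: mu_fun_eq divide_right_mono)
qed

lemma mu_eq: "mu = mu_fun mu_arg"
  unfolding mu_def by (rule Greatest_equality) (use mu_arg_pos mu_fun_le in auto)

lemma mu_closed_form: "mu = (2 / 3) powr (3 / 2) * ((1 + 2 * sqrt 7) / sqrt (2 + sqrt 7))"
proof -
  define s where "s = sqrt (2 + sqrt 7)"
  have s: "s > 0" by (simp add: s_def add_pos_nonneg)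
  have "sqrt (1 + mu_arg) = s / sqrt 3"
    by (simp add: mu_arg_def s_def real_sqrt_divide[symmetric] field_simps)
  moreover have "2 + 2 * mu_arg - mu_arg\<^sup>2 = 4 * (1 + 2 * sqrt 7) / 9"
    by (simp add: mu_arg_def power2_eq_square field_simps)
  ultimately have "mu = (4 * (1 + 2 * sqrt 7) / 9) / (sqrt 2 * (s / sqrt 3))"
    unfolding mu_eq mu_fun_def by (simp only:)
  also have "\<dots> = (4 * sqrt 3 / (9 * sqrt 2)) * ((1 + 2 * sqrt 7) / s)"
    using s by (simp add: field_simps)
  also have "4 * sqrt 3 / (9 * sqrt 2) = (2 / 3) * sqrt (2 / 3)"
    by (simp add: real_sqrt_divide field_simps)
  also have "(2 / 3) * sqrt (2 / 3) = (2 / 3 :: real) powr (3 / 2)"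
    using powr_add[of "2 / 3 :: real" 1 "1 / 2"] by (simp add: powr_half_sqrt)
  finally show ?thesis by (simp add: s_def)
qed

lemma mu_approx: "\<bar>mu - 1.58887\<bar> < 0.000005"
proof -
  define s where "s = sqrt (7::real)"
  have s1: "2.6457513 < s" unfolding s_def by (rule real_less_rsqrt) (simp add: power2_eq_square)
  have s2: "s < 2.6457514" unfolding s_def by (rule real_less_lsqrt) (simp_all add: power2_eq_square)
  define d where "d = sqrt 2 * sqrt (1 + mu_arg)"
  have d: "d = sqrt (2 * (2 + s) / 3)"
    by (simp add: d_def mu_arg_def s_def real_sqrt_mult[symmetric] field_simps)
  have d1: "1.7598770 < d" unfolding d using s1 by (intro real_less_rsqrt) (simp add: power2_eq_square)
  have d2: "d < 1.7598772" unfolding d using s2 s1 by (intro real_less_lsqrt) (simp_all add: power2_eq_square)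
  have n: "2 + 2 * mu_arg - mu_arg\<^sup>2 = 4 * (1 + 2 * s) / 9"
    by (simp add: mu_arg_def s_def power2_eq_square field_simps)
  have "mu = 4 * (1 + 2 * s) / 9 / d"
    by (simp add: mu_eq mu_fun_def n d_def)
  moreover have "4 * (1 + 2 * s) / 9 / d < 1.588875" "1.588865 < 4 * (1 + 2 * s) / 9 / d"
    using s1 s2 d1 d2 by (simp_all add: pos_divide_less_eq pos_less_divide_eq)
  ultimately have "mu < 1.588875" "1.588865 < mu" by (simp_all only:)
  then show ?thesis unfolding abs_less_iff by simp
qed

section \<open>Choice of the prime and of the hexagon\<close>

lemma eventually_DD_bar_star:
  "\<forall>\<^sub>F r in at_top. \<exists>m A. DD_bar_star m r A \<and> 0.79444 * real r \<le> real m"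
proof -
  define n where "n = (\<lambda>r::nat. nat \<lceil>0.8 * real r\<rceil>)"
  have "filterlim n at_top at_top" unfolding n_def by real_asymp
  from eventually_compose_filterlim[OF eventually_prime_between this]
  have primes: "\<forall>\<^sub>F r in at_top. \<exists>p. prime p \<and> n r < p \<and> real p \<le> 1.175 * real (n r)" .
  \<comment> \<open>\<open>0.5754\<close> exceeds \<open>sqrt (0.79444 / 3 * 1.25)\<close>, where
    \<open>1.25 = 1 / 0.8\<close> bounds \<open>r / p\<close>. The gap up to \<open>0.577\<close>
    absorbs the lower-order terms.\<close>
  have "\<forall>\<^sub>F x in at_top. 0.5754 * x + 1 \<le> 0.577 * x - 11 * sqrt x - (22::real)"
    by real_asymp
  then obtain p0 where p0: "\<And>x. x \<ge> p0 \<Longrightarrow> 0.5754 * x + 1 \<le> 0.577 * x - 11 * sqrt x - (22::real)"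
    by (auto simp: eventually_at_top_linorder)
  \<comment> \<open>Here \<open>0.94 = 0.8 * 1.175\<close> comes from the upper bound for
    \<open>p\<close>, and \<open>0.79444 / 3 * 0.94 < 0.499^2\<close> will keep \<open>2 * R\<close>
    within \<open>r\<close>.\<close>
  have "\<forall>\<^sub>F r in at_top. 0.79444 / 3 * real r * (0.94 * real r + 1.175) \<le> (0.499 * real r)\<^sup>2"
  proof -
    have "\<forall>\<^sub>F r::nat in at_top. r \<ge> 10000" by (rule eventually_ge_at_top)
    then show ?thesis
    proof eventually_elim
      case (elim r)
      then have "10000 * real r \<le> real r * real r" by (intro mult_right_mono) auto
      then show ?case by (simp add: power2_eq_square algebra_simps)
    qed
  qed
  moreover have "\<forall>\<^sub>F r in at_top. 0.499 * real r + 1 \<le> real r / 2" by real_asymp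
  moreover have "\<forall>\<^sub>F r in at_top. p0 \<le> 0.8 * real r" by real_asymp
  ultimately show ?thesis
    using primes
  proof eventually_elim
    case (elim r)
    obtain p where p: "prime p" "n r < p" "real p \<le> 1.175 * real (n r)"
      using elim(4) by blast
    have "real (n r) = real_of_int \<lceil>0.8 * real r\<rceil>"
      unfolding n_def by (rule of_nat_nat) simp
    then have "0.8 * real r \<le> real (n r)" "real (n r) \<le> 0.8 * real r + 1" by linarith+
    then have pr: "0.8 * real r \<le> real p" "real p \<le> 0.94 * real r + 1.175"
      using p(2,3) by simp_all
    \<comment> \<open>The value of \<open>R^2\<close> for which \<open>3 * R^2 / p\<close> is
      exactly \<open>0.79444 * r\<close>; hence its root is rounded up.\<close>
    define z where "z = 0.79444 / 3 * real r * real p"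
    have z: "z \<ge> 0" by (simp add: z_def)
    define R where "R = nat \<lfloor>sqrt z\<rfloor> + 1"
    have "real (nat \<lfloor>sqrt z\<rfloor>) = real_of_int \<lfloor>sqrt z\<rfloor>"
      by (rule of_nat_nat) (simp add: z)
    then have R: "sqrt z \<le> real R" "real R \<le> sqrt z + 1"
      unfolding R_def by linarith+
    have "z \<le> 0.79444 / 3 * real r * (0.94 * real r + 1.175)"
      unfolding z_def using pr(2) by (intro mult_left_mono) auto
    also have "\<dots> \<le> (0.499 * real r)\<^sup>2" by (rule elim(1))
    finally have "sqrt z \<le> 0.499 * real r"
      by (intro real_le_lsqrt) auto
    then have "real R \<le> real r / 2" using R(2) elim(2) by linarith
    then have Rr: "2 * R \<le> r" by linarith
    have "z \<le> 0.79444 / 3 * (1.25 * real p) * real p"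
      unfolding z_def using pr(1) by (intro mult_right_mono mult_left_mono) auto
    also have "\<dots> = (0.79444 / 3 * 1.25) * (real p * real p)" by simp
    also have "\<dots> \<le> 0.5754\<^sup>2 * (real p * real p)"
      by (intro mult_right_mono) (simp_all add: power2_eq_square)
    also have "\<dots> = (0.5754 * real p)\<^sup>2" by (simp add: power2_eq_square)
    finally have "z \<le> (0.5754 * real p)\<^sup>2" .
    then have "sqrt z \<le> 0.5754 * real p"
      by (intro real_le_lsqrt) auto
    then have "real R \<le> 0.577 * real p - 11 * sqrt (real p) - 22"
      using R(2) p0[of "real p"] elim(3) pr(1) by linarith
    from DD_bar_star_prime[OF p(1) this Rr] obtain m A where
      mA: "DD_bar_star m r A" "3 * R\<^sup>2 \<le> p * m" by blast
    have "0.79444 * real r * real p = 3 * (sqrt z)\<^sup>2"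
      using z by (simp add: z_def)
    also have "\<dots> \<le> 3 * (real R)\<^sup>2"
      using R(1) z by (intro mult_left_mono power_mono) auto
    also have "\<dots> \<le> real m * real p"
      using of_nat_mono[OF mA(2), where ?'a = real] by (simp add: mult.commute)
    finally have "0.79444 * real r \<le> real m"
      using prime_gt_0_nat[OF p(1)] by (simp add: mult_le_cancel_right)
    then show ?case using mA(1) by blast
  qed
qed

theorem theorem20:
  shows "(\<exists>a>0. mu = mu_fun a) \<and> (\<forall>a>0. mu_fun a \<le> mu)
    \<and> mu = (2 / 3) powr (3 / 2) * ((1 + 2 * sqrt 7) / sqrt (2 + sqrt 7))
    \<and> \<bar>mu - 1.58887\<bar> < 0.000005
    \<and> (\<exists>g :: nat \<Rightarrow> real.
          (\<lambda>r. g r / real r) \<longlonglongrightarrow> 0 \<and>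
          (\<forall>r>0. \<exists>m A. DD_bar_star m r A \<and> real m \<ge> mu / 2 * real r - g r))"
proof (intro conjI)
  show "\<exists>a>0. mu = mu_fun a" using mu_eq mu_arg_pos by blast
  show "\<forall>a>0. mu_fun a \<le> mu" using mu_eq mu_fun_le by simp
  show "mu = (2 / 3) powr (3 / 2) * ((1 + 2 * sqrt 7) / sqrt (2 + sqrt 7))" by (rule mu_closed_form)
  show "\<bar>mu - 1.58887\<bar> < 0.000005" by (rule mu_approx)
  obtain r0 where r0: "\<And>r. r \<ge> r0 \<Longrightarrow> \<exists>m A. DD_bar_star m r A \<and> 0.79444 * real r \<le> real m"
    using eventually_DD_bar_star by (auto simp: eventually_at_top_linorder)
  \<comment> \<open>Below \<open>r0\<close> the empty set serves as witness and \<open>g\<close>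
    makes the required bound 0.\<close>
  define g where "g = (\<lambda>r. if r < r0 then mu / 2 * real r else 0)"
  have "\<forall>\<^sub>F r in sequentially. g r / real r = 0"
    using eventually_ge_at_top[of r0] by eventually_elim (simp add: g_def)
  then have "(\<lambda>r. g r / real r) \<longlonglongrightarrow> 0"
    by (rule tendsto_eventually)
  moreover have "\<exists>m A. DD_bar_star m r A \<and> real m \<ge> mu / 2 * real r - g r" for r
  proof (cases "r < r0")
    case True
    have "DD_bar_star 0 r {}" by (simp add: DD_bar_star_def)
    then show ?thesis using True by (intro exI[of _ 0] exI[of _ "{}"]) (simp add: g_def)
  next
    case False
    then obtain m A where mA: "DD_bar_star m r A" "0.79444 * real r \<le> real m"
      using r0[of r] by (meson not_less)
    \<comment> \<open>The half of \<mu> is about 0.794435, so the five-digit constant lies just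
      above it.\<close>
    have "mu / 2 \<le> 0.79444" using mu_approx unfolding abs_less_iff by simp
    then have "mu / 2 * real r \<le> 0.79444 * real r" by (rule mult_right_mono) simp
    then show ?thesis using mA False by (intro exI[of _ m] exI[of _ A]) (simp add: g_def)
  qed
  ultimately show "\<exists>g :: nat \<Rightarrow> real. (\<lambda>r. g r / real r) \<longlonglongrightarrow> 0 \<and>
      (\<forall>r>0. \<exists>m A. DD_bar_star m r A \<and> real m \<ge> mu / 2 * real r - g r)"
    by blast
qed

end
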